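(* The adaptivity gap of the maximum load assortment problem is at least $4/3$, i.e. $$\sup_{I}\ \frac{\mathrm{OPT}^{\mathrm{DP}}_I}{\mathrm{OPT}^{\mathrm{Static}}_I}\ \ge\ \frac43,$$ where the supremum is over all instances $I$.
   Context: An instance $I$ consists of a number of customers $T\ge1$, a number of products $n\ge1$, and preference weights $v_1,\dots,v_n>0$ of the products $\mathcal{N}=\{1,\dots,n\}$; the no-purchase option $0$ has weight $1$. Multinomial Logit (MNL) model: for $S\subseteq\mathcal{N}$ let $v(S)=\sum_{i\in S}v_i$, $\phi_i(S)=\frac{v_i}{1+v(S)}$ for $i\in S$, and $\phi_0(S)=\frac{1}{1+v(S)}$. Static setting: when $S$ is offered to all $T$ customers, each customer independently chooses option $i\in S\cup\{0\}$ with probability $\phi_i(S)$; $L_i(S)$ is the number of customers choosing product $i$ and $M(S)=\max_{i\in S}L_i(S)$ (with $M(\emptyset)=0$). Define $\mathrm{OPT}^{\mathrm{Static}}_I=\max_{S\subseteq\mathcal{N}}\mathbb{E}(M(S))$. Dynamic setting: customers arrive one by one, and the assortment offered to each customer may depend on the current load vector $\boldsymbol\ell\in\mathbb{Z}_{\ge0}^n$ (the number of previous customers who chose each product) and on the number of remaining customers; a customer offered $S$ chooses $i\in S\cup\{0\}$ with probability $\phi_i(S)$. Let $\mathcal{M}_0(\boldsymbol\ell)=\max_i\ell_i$ and $$\mathcal{M}_t(\boldsymbol\ell)=\max_{S\subseteq\mathcal{N}}\Big(\mathcal{M}_{t-1}(\boldsymbol\ell)\,\phi_0(S)+\sum_{i\in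 S}\mathcal{M}_{t-1}(\boldsymbol\ell+\mathbf{e}_i)\,\phi_i(S)\Big),$$ where $\mathbf{e}_i$ is the $i$-th unit vector. Then $\mathrm{OPT}^{\mathrm{DP}}_I=\mathcal{M}_T(\mathbf{0})$ is the optimal expected maximum load of an adaptive policy. *)

theory Defs
  imports "HOL-Probability.Probability"
begin

(* The products are the naturals 1, ..., n; the natural 0 is the no-purchase option, whose
   weight is 1.  Only the values v 1, ..., v n of a weight function matter. *)

definition total_weight :: "(nat \<Rightarrow> real) \<Rightarrow> nat set \<Rightarrow> real" where
  "total_weight v S = (\<Sum>i\<in>S. v i)"

definition choice_prob :: "(nat \<Rightarrow> real) \<Rightarrow> nat set \<Rightarrow> nat \<Rightarrow> real" where
  "choice_prob v S i = (if i = 0 then 1 else v i) / (1 + total_weight v S)"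

definition mnl_pmf :: "(nat \<Rightarrow> real) \<Rightarrow> nat set \<Rightarrow> nat pmf" where
  "mnl_pmf v S = embed_pmf (\<lambda>i. if i \<in> insert 0 S then choice_prob v S i else 0)"

(* embed_pmf is only meaningful for a genuine probability mass function; this is one. *)
lemma pmf_mnl_pmf:
  assumes "\<forall>i\<in>{1..n}. v i > 0" "S \<subseteq> {1..n}"
  shows "pmf (mnl_pmf v S) i = (if i \<in> insert 0 S then choice_prob v S i else 0)"
proof -
  let ?f = "\<lambda>i. if i \<in> insert 0 S then choice_prob v S i else 0"
  have fin: "finite S" using assms(2) finite_subset by blast
  have pos: "v i > 0" if "i \<in> S" for i using assms that by blast
  have zero: "0 \<notin> S" using assms(2) by auto
  have tw: "total_weight v S \<ge> 0"
    unfolding total_weight_def by (intro sum_nonneg) (use pos in \<open>auto intro: less_imp_le\<close>)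
  have nonneg: "?f i \<ge> 0" for i
    using tw pos[of i] by (auto simp: choice_prob_def)
  have "(\<Sum>i\<in>S. choice_prob v S i) = (\<Sum>i\<in>S. v i / (1 + total_weight v S))"
    using zero by (intro sum.cong) (auto simp: choice_prob_def)
  also have "\<dots> = total_weight v S / (1 + total_weight v S)"
    by (simp add: total_weight_def sum_divide_distrib)
  finally have "(\<Sum>i\<in>insert 0 S. ?f i) = 1"
    using fin zero tw by (simp add: choice_prob_def add_divide_distrib[symmetric])
  moreover have "(\<integral>\<^sup>+i. ennreal (?f i) \<partial>count_space UNIV)
      = (\<Sum>i\<in>insert 0 S. ennreal (?f i))"
    using fin by (intro nn_integral_count_space') auto
  moreover have "(\<Sum>i\<in>insert 0 S. ennreal (?f i)) = ennreal (\<Sum>i\<in>insert 0 S. ?f i)"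
    by (rule sum_ennreal) (rule nonneg)
  ultimately have "(\<integral>\<^sup>+i. ennreal (?f i) \<partial>count_space UNIV) = 1"
    by (metis ennreal_1)
  then show ?thesis
    unfolding mnl_pmf_def by (intro pmf_embed_pmf nonneg)
qed

(* An outcome c assigns to each of the customers 0, ..., T - 1 the chosen option. *)
definition load :: "nat \<Rightarrow> (nat \<Rightarrow> nat) \<Rightarrow> nat \<Rightarrow> nat" where
  "load T c i = card {t \<in> {..<T}. c t = i}"

definition max_load :: "nat \<Rightarrow> nat set \<Rightarrow> (nat \<Rightarrow> nat) \<Rightarrow> nat" where
  "max_load T S c = (if S = {} then 0 else Max (load T c ` S))"

(* Pi_pmf draws the choices of the T customers independently from mnl_pmf v S; its second
   argument is merely the value of c outside {..<T}. *)
definition expected_max_load :: "nat \<Rightarrow> (nat \<Rightarrow> real) \<Rightarrow> nat set \<Rightarrow> real" where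
  "expected_max_load T v S =
     measure_pmf.expectation (Pi_pmf {..<T} 0 (\<lambda>_. mnl_pmf v S)) (\<lambda>c. real (max_load T S c))"

definition OPT_static :: "nat \<Rightarrow> nat \<Rightarrow> (nat \<Rightarrow> real) \<Rightarrow> real" where
  "OPT_static T n v = Max (expected_max_load T v ` Pow {1..n})"

primrec DP_value :: "nat \<Rightarrow> (nat \<Rightarrow> real) \<Rightarrow> nat \<Rightarrow> (nat \<Rightarrow> nat) \<Rightarrow> real" where
  "DP_value n v 0 l = real (Max (l ` {1..n}))"
| "DP_value n v (Suc t) l =
     Max ((\<lambda>S. DP_value n v t l * choice_prob v S 0
               + (\<Sum>i\<in>S. DP_value n v t (l(i := l i + 1)) * choice_prob v S i)) ` Pow {1..n})"

definition OPT_DP :: "nat \<Rightarrow> nat \<Rightarrow> (nat \<Rightarrow> real) \<Rightarrow> real" where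
  "OPT_DP T n v = DP_value n v T (\<lambda>_. 0)"

definition instances :: "(nat \<times> nat \<times> (nat \<Rightarrow> real)) set" where
  "instances = {(T, n, v). T \<ge> 1 \<and> n \<ge> 1 \<and> (\<forall>i\<in>{1..n}. v i > 0)}"

end

theory Submission
  imports Defs
begin

text \<open>The gap is already approached by two customers and many products of weight \<open>1\<close>.

  An adaptive policy offers all \<open>n\<close> products to the first customer, who buys something
  with probability \<open>n / (n + 1)\<close>, and then offers the second customer only the product that was
  just bought, which is bought again with probability \<open>1 / 2\<close>.  So the adaptive optimum is at least
  \<open>3 / 2 \<cdot> n / (n + 1)\<close> (\<open>OPT_DP_two_unit_weights\<close>).

  A static policy has to choose between the two goals of selling at all and of selling
  the same product twice.  With \<open>k \<ge> 1\<close> products on offer, the maximum load is at least \<open>1\<close> with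
  probability \<open>1 - 1 / (k + 1)\<^sup>2\<close> and equal to \<open>2\<close> with probability \<open>k / (k + 1)\<^sup>2\<close>, so its
  expectation is \<open>1 + (k - 1) / (k + 1)\<^sup>2\<close>.  This is largest for \<open>k = 3\<close>, because
  \<open>(k + 1)\<^sup>2 - 8 (k - 1) = (k - 3)\<^sup>2\<close>, and the static optimum never exceeds \<open>9 / 8\<close>
  (\<open>OPT_static_two_unit_weights\<close>).  The quotient of the two bounds is \<open>4 / 3 \<cdot> n / (n + 1)\<close>,
  which tends to \<open>4 / 3\<close>.\<close>

text \<open>The maximum load of two customers counts two events: somebody buys, and both buy the same
  product.  As each summand is a product over the customers, its expectation factorises by
  independence.\<close>

lemma max_load_two:
  assumes "finite S"
  shows "real (max_load 2 S c) =
    1 - (\<Prod>t\<in>{..<2}. indicator (- S) (c t)) + (\<Sum>i\<in>S. \<Prod>t\<in>{..<2}. indicator {i} (c t))"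
proof -
  have two: "{..<2} = {0, 1::nat}" by auto
  have load: "load 2 c i = (if c 0 = i then 1 else 0) + (if c 1 = i then 1 else 0)" for i
  proof -
    have "{t \<in> {..<2}. c t = i} = (if c 0 = i then {0} else {}) \<union> (if c 1 = i then {1} else {})"
      by (auto dest!: less_2_cases)
    then show ?thesis by (auto simp: load_def)
  qed
  have pairs: "(\<Sum>i\<in>S. \<Prod>t\<in>{..<2}. indicator {i} (c t))
      = (if c 0 = c 1 \<and> c 0 \<in> S then 1 else 0 :: real)"
  proof -
    have "(\<Sum>i\<in>S. \<Prod>t\<in>{..<2}. indicator {i} (c t))
        = (\<Sum>i\<in>S. if c 0 = i then (if c 0 = c 1 then 1 else 0) else 0 :: real)"
      by (intro sum.cong) (auto simp: two indicator_def)
    then show ?thesis using assms by (simp add: sum.delta)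
  qed
  have "max_load 2 S c
      = (if c 0 \<in> S \<or> c 1 \<in> S then 1 else 0) + (if c 0 = c 1 \<and> c 0 \<in> S then 1 else 0)"
  proof (cases "S = {}")
    case False
    then obtain s where s: "s \<in> S" by blast
    have "Max (load 2 c ` S)
      = (if c 0 \<in> S \<or> c 1 \<in> S then 1 else 0) + (if c 0 = c 1 \<and> c 0 \<in> S then 1 else 0)"
    proof (rule Max_eqI)
      show "(if c 0 \<in> S \<or> c 1 \<in> S then 1 else 0) + (if c 0 = c 1 \<and> c 0 \<in> S then 1 else 0)
          \<in> load 2 c ` S"
        using s
        by (intro image_eqI[where x = "if c 0 \<in> S then c 0 else if c 1 \<in> S then c 1 else s"])
           (auto simp: load)
    qed (use assms in \<open>auto simp: load\<close>)
    with False show ?thesis by (simp add: max_load_def)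
  qed (simp add: max_load_def)
  then show ?thesis
    unfolding pairs by (auto simp: two indicator_def)
qed

lemma expected_max_load_two:
  assumes "finite S"
  shows "expected_max_load 2 v S =
    1 - (1 - measure_pmf.prob (mnl_pmf v S) S)\<^sup>2 + (\<Sum>i\<in>S. (pmf (mnl_pmf v S) i)\<^sup>2)"
proof -
  let ?P = "Pi_pmf {..<2::nat} 0 (\<lambda>_. mnl_pmf v S)"
  have int: "integrable (measure_pmf ?P) (\<lambda>c. \<Prod>t\<in>{..<2}. indicator A (c t) :: real)" for A
    by (intro measure_pmf.integrable_const_bound[where B = 1])
       (auto simp: indicator_def prod_le_1 abs_prod intro!: AE_I2 prod_le_1)
  have ex: "measure_pmf.expectation ?P (\<lambda>c. \<Prod>t\<in>{..<2}. indicator A (c t))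
      = (measure_pmf.prob (mnl_pmf v S) A)\<^sup>2" for A
    by (subst expectation_prod_Pi_pmf)
       (auto intro!: integrable_real_indicator simp: measure_pmf.emeasure_eq_measure)
  have "expected_max_load 2 v S = 1 - (measure_pmf.prob (mnl_pmf v S) (- S))\<^sup>2
      + (\<Sum>i\<in>S. (measure_pmf.prob (mnl_pmf v S) {i})\<^sup>2)"
    unfolding expected_max_load_def max_load_two[OF assms]
    by (simp add: int ex Bochner_Integration.integral_add Bochner_Integration.integral_diff
        Bochner_Integration.integral_sum)
  moreover have "measure_pmf.prob (mnl_pmf v S) (- S) = 1 - measure_pmf.prob (mnl_pmf v S) S"
    using measure_pmf.prob_compl[of S "mnl_pmf v S"] by (simp add: Compl_eq_Diff_UNIV)
  ultimately show ?thesis by (simp add: measure_pmf_single)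
qed

lemma expected_max_load_two_unit_weights:
  assumes "S \<subseteq> {1..n}"
  shows "expected_max_load 2 (\<lambda>_. 1) S =
    1 - 1 / (1 + real (card S))\<^sup>2 + real (card S) / (1 + real (card S))\<^sup>2"
proof -
  let ?k = "real (card S)"
  have fin: "finite S" using assms finite_subset by blast
  have pmf: "pmf (mnl_pmf (\<lambda>_. 1) S) i = 1 / (1 + ?k)" if "i \<in> S" for i
    using that assms by (subst pmf_mnl_pmf[where n = n]) (auto simp: choice_prob_def total_weight_def)
  have "measure_pmf.prob (mnl_pmf (\<lambda>_. 1) S) S = ?k / (1 + ?k)"
    using fin by (simp add: measure_measure_pmf_finite pmf)
  moreover have "1 - ?k / (1 + ?k) = 1 / (1 + ?k)" by (simp add: field_simps)
  ultimately show ?thesis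
    unfolding expected_max_load_two[OF fin] by (simp add: pmf power_divide)
qed

lemma OPT_static_two_unit_weights:
  assumes "n \<ge> 1"
  shows "OPT_static 2 n (\<lambda>_. 1) \<le> 9 / 8" and "OPT_static 2 n (\<lambda>_. 1) > 0"
proof -
  have fin: "finite (expected_max_load 2 (\<lambda>_. 1) ` Pow {1..n})" by simp
  have "expected_max_load 2 (\<lambda>_. 1) S \<le> 9 / 8" if "S \<in> Pow {1..n}" for S
  proof -
    have "(1 + real (card S))\<^sup>2 > 0" by (simp add: add_pos_nonneg)
    moreover have "8 * (real (card S) - 1) \<le> (1 + real (card S))\<^sup>2"
      using zero_le_power2[of "real (card S) - 3"] by (simp add: power2_eq_square algebra_simps)
    ultimately have "(real (card S) - 1) / (1 + real (card S))\<^sup>2 \<le> 1 / 8"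
      by (simp add: divide_le_eq)
    then show ?thesis
      using that by (simp add: expected_max_load_two_unit_weights diff_divide_distrib)
  qed
  then show "OPT_static 2 n (\<lambda>_. 1) \<le> 9 / 8"
    unfolding OPT_static_def using fin by (subst Max_le_iff) auto
  have "expected_max_load 2 (\<lambda>_. 1) {1} \<le> OPT_static 2 n (\<lambda>_. 1)"
    unfolding OPT_static_def using assms by (intro Max_ge fin) auto
  moreover have "expected_max_load 2 (\<lambda>_. 1) {1} = 1"
    using assms by (subst expected_max_load_two_unit_weights[where n = n]) auto
  ultimately show "OPT_static 2 n (\<lambda>_. 1) > 0" by simp
qed

lemma DP_value_Suc_ge:
  assumes "S \<subseteq> {1..n}"
  shows "DP_value n v t l * choice_prob v S 0
      + (\<Sum>i\<in>S. DP_value n v t (l(i := l i + 1)) * choice_prob v S i) \<le> DP_value n v (Suc t) l"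
  unfolding DP_value.simps using assms by (intro Max_ge) auto

lemma DP_value_0_ge:
  assumes "i \<in> {1..n}"
  shows "real (l i) \<le> DP_value n v 0 l"
  using assms by simp

lemma OPT_DP_two_unit_weights:
  "3 / 2 * (real n / (real n + 1)) \<le> OPT_DP 2 n (\<lambda>_. 1)"
proof (cases "n = 0")
  case False
  let ?v = "\<lambda>_. 1 :: real" and ?z = "\<lambda>_. 0 :: nat"
  have one: "DP_value n ?v 1 (?z(i := 1)) \<ge> 3 / 2" if i: "i \<in> {1..n}" for i
  proof -
    have "DP_value n ?v 0 (?z(i := 1)) \<ge> 1" "DP_value n ?v 0 (?z(i := 2)) \<ge> 2"
      using DP_value_0_ge[OF i, of "?z(i := 1)" ?v] DP_value_0_ge[OF i, of "?z(i := 2)" ?v]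
      by (simp_all del: DP_value.simps)
    moreover have "DP_value n ?v 0 (?z(i := 1)) * (1 / 2) + DP_value n ?v 0 (?z(i := 2)) * (1 / 2)
        \<le> DP_value n ?v 1 (?z(i := 1))"
      using DP_value_Suc_ge[of "{i}" n ?v 0 "?z(i := 1)"] i
      by (simp add: choice_prob_def total_weight_def numeral_2_eq_2 del: DP_value.simps)
    ultimately show ?thesis by linarith
  qed
  have zero: "DP_value n ?v 1 ?z \<ge> 0"
  proof -
    have "DP_value n ?v 0 ?z \<ge> 0" by simp
    then show ?thesis
      using DP_value_Suc_ge[of "{}" n ?v 0 ?z]
      by (simp add: choice_prob_def total_weight_def del: DP_value.simps)
  qed
  have "3 / 2 * (real n / (real n + 1)) = (\<Sum>i\<in>{1..n}. 3 / 2 * choice_prob ?v {1..n} i)"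
    by (simp add: choice_prob_def total_weight_def add.commute)
  also have "\<dots> \<le> (\<Sum>i\<in>{1..n}. DP_value n ?v 1 (?z(i := ?z i + 1)) * choice_prob ?v {1..n} i)"
    using one by (intro sum_mono mult_right_mono)
      (auto simp: choice_prob_def total_weight_def simp del: DP_value.simps)
  also have "\<dots> \<le> DP_value n ?v 1 ?z * choice_prob ?v {1..n} 0 + \<dots>"
    using zero by (simp add: choice_prob_def total_weight_def del: DP_value.simps)
  also have "\<dots> \<le> OPT_DP 2 n ?v"
    unfolding OPT_DP_def using DP_value_Suc_ge[of "{1..n}" n ?v 1 ?z]
    by (simp add: numeral_2_eq_2 del: DP_value.simps)
  finally show ?thesis .
qed (simp add: OPT_DP_def numeral_2_eq_2 choice_prob_def total_weight_def)

theorem lemma4p9: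
  shows "(SUP (T, n, v)\<in>instances. ereal (OPT_DP T n v / OPT_static T n v)) \<ge> ereal (4 / 3)"
proof (rule LIMSEQ_le_const2)
  have "(\<lambda>n. 4 / 3 * (real n / (real n + 1))) \<longlonglongrightarrow> 4 / 3 * 1"
    using LIMSEQ_n_over_Suc_n by (intro tendsto_mult tendsto_const) (simp add: add.commute)
  then show "(\<lambda>n. ereal (4 / 3 * (real n / (real n + 1)))) \<longlonglongrightarrow> ereal (4 / 3)"
    by simp
  have "ereal (4 / 3 * (real n / (real n + 1)))
      \<le> (SUP (T, n, v)\<in>instances. ereal (OPT_DP T n v / OPT_static T n v))" if "n \<ge> 1" for n
  proof (rule SUP_upper2[where i = "(2, n, \<lambda>_. 1)"])
    have "4 / 3 * (real n / (real n + 1)) = (3 / 2 * (real n / (real n + 1))) / (9 / 8)"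
      by (simp add: divide_simps)
    also have "\<dots> \<le> OPT_DP 2 n (\<lambda>_. 1) / OPT_static 2 n (\<lambda>_. 1)"
    proof (rule frac_le)
      show "3 / 2 * (real n / (real n + 1)) \<le> OPT_DP 2 n (\<lambda>_. 1)"
        by (rule OPT_DP_two_unit_weights)
      then show "0 \<le> OPT_DP 2 n (\<lambda>_. 1)"
        by (rule order_trans[rotated]) simp
    qed (use OPT_static_two_unit_weights[OF that] in auto)
    finally show "ereal (4 / 3 * (real n / (real n + 1)))
        \<le> (case (2, n, \<lambda>_. 1) of (T, n, v) \<Rightarrow> ereal (OPT_DP T n v / OPT_static T n v))"
      by simp
  qed (use that in \<open>simp add: instances_def\<close>)
  then show "\<exists>N. \<forall>n\<ge>N. ereal (4 / 3 * (real n / (real n + 1)))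
      \<le> (SUP (T, n, v)\<in>instances. ereal (OPT_DP T n v / OPT_static T n v))"
    by blast
qed

end
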